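(* Let $\alpha\in(0,1)$, $\sigma>0$, $\beta\in[-1,1]$, let $C_+=\sigma^\alpha(1-i\beta\tan(\alpha\pi/2))$ and $\varphi_0=\arg C_+=-\arctan(\beta\tan(\alpha\pi/2))$, and let $p$ be the corresponding stable density. Let $x'\in\mathbb{R}\setminus\{0\}$ satisfy $|x'|+|C_+|\cos\left(\varphi_0-(\operatorname{sign} x')\frac{\alpha\pi}{2}\right)>0$. Then: (i) if $x'<0$, $$p(x')=\frac{1}{\pi}\int_{\mathbb{R}} e^{y+x'e^{y}-|C_+|\cos(\varphi_0+\frac{\alpha\pi}{2})e^{\alpha y}}\,\sin\left(|C_+|\sin\left(\varphi_0+\tfrac{\alpha\pi}{2}\right)e^{\alpha y}\right)dy;$$ (ii) if $x'>0$, $$p(x')=-\frac{1}{\pi}\int_{\mathbb{R}} e^{y-x'e^{y}-|C_+|\cos(\varphi_0-\frac{\alpha\pi}{2})e^{\alpha y}}\,\sin\left(|C_+|\sin\left(\varphi_0-\tfrac{\alpha\pi}{2}\right)e^{\alpha y}\right)dy.$$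
   Context: The stable density (centered, index $\alpha\in(0,1)$, scale $\sigma$, asymmetry $\beta$) is $$p(x')=\frac{1}{2\pi}\int_{\mathbb{R}} e^{-ix'\xi-\psi^0_{st}(\xi)}\,d\xi=\frac1\pi\operatorname{Re}\int_0^{+\infty}e^{-ix'\xi-C_+\xi^\alpha}d\xi,$$ where $\psi^0_{st}(\xi)=\sigma^\alpha(1-i\beta\tan(\alpha\pi/2)\operatorname{sign}\xi)|\xi|^\alpha$, that is, $\psi^0_{st}(\xi)=C_+|\xi|^\alpha$ for $\xi>0$ and $\psi^0_{st}(\xi)=\overline{C_+}|\xi|^\alpha$ for $\xi<0$. Here $x'=x-\mu$, where $\mu$ is the location parameter. *)

theory Defs
  imports "HOL-Analysis.Analysis"
begin

definition stable_C_plus :: "real \<Rightarrow> real \<Rightarrow> real \<Rightarrow> complex" where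
  "stable_C_plus \<alpha> \<sigma> \<beta> =
     complex_of_real (\<sigma> powr \<alpha>) * (1 - \<i> * complex_of_real (\<beta> * tan (\<alpha> * pi / 2)))"

definition stable_exponent :: "real \<Rightarrow> real \<Rightarrow> real \<Rightarrow> real \<Rightarrow> complex" where
  "stable_exponent \<alpha> \<sigma> \<beta> \<xi> =
     complex_of_real (\<sigma> powr \<alpha>)
       * (1 - \<i> * complex_of_real (\<beta> * tan (\<alpha> * pi / 2) * sgn \<xi>))
       * complex_of_real (\<bar>\<xi>\<bar> powr \<alpha>)"

text \<open>The inversion integral is complex-valued, so the density is kept in the complex
  numbers; it is not projected to its real part.\<close>

definition stable_density :: "real \<Rightarrow> real \<Rightarrow> real \<Rightarrow> real \<Rightarrow> complex" where
  "stable_density \<alpha> \<sigma> \<beta> x' =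
     1 / (2 * complex_of_real pi)
       * (LINT \<xi>|lborel. exp (- \<i> * complex_of_real (x' * \<xi>) - stable_exponent \<alpha> \<sigma> \<beta> \<xi>))"

lemma stable_exponent_pos:
  "\<xi> > 0 \<Longrightarrow> stable_exponent \<alpha> \<sigma> \<beta> \<xi>
     = stable_C_plus \<alpha> \<sigma> \<beta> * complex_of_real (\<bar>\<xi>\<bar> powr \<alpha>)"
  by (simp add: stable_exponent_def stable_C_plus_def)

lemma stable_exponent_neg:
  "\<xi> < 0 \<Longrightarrow> stable_exponent \<alpha> \<sigma> \<beta> \<xi>
     = cnj (stable_C_plus \<alpha> \<sigma> \<beta>) * complex_of_real (\<bar>\<xi>\<bar> powr \<alpha>)"
  by (simp add: stable_exponent_def stable_C_plus_def)

lemma Arg_stable_C_plus: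
  assumes "\<sigma> > 0"
  shows "Arg (stable_C_plus \<alpha> \<sigma> \<beta>) = - arctan (\<beta> * tan (\<alpha> * pi / 2))"
proof -
  have "Re (stable_C_plus \<alpha> \<sigma> \<beta>) > 0"
    using assms by (simp add: stable_C_plus_def)
  then show ?thesis
    using assms by (simp add: arg_conv_arctan) (simp add: stable_C_plus_def arctan_minus)
qed

end

theory Submission
  imports
    Defs
    "HOL-Complex_Analysis.Complex_Analysis"
    "HOL-Probability.Sinc_Integral"
    "HOL-Real_Asymp.Real_Asymp"
begin

text \<open>
  The density is \<open>1 / \<pi>\<close> times the real part of an integral over the half-line \<open>\<xi> > 0\<close>. Complex
  conjugation reduces \<open>x' > 0\<close> to \<open>x' < 0\<close>, with \<open>C\<close> replaced by its conjugate. For \<open>x' < 0\<close> the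
  ray is rotated by \<open>\<pi> / 2\<close>: after \<open>\<xi> = exp w\<close> the integrand is entire in \<open>w\<close>, so there is no
  branch point to avoid, and the rotation is a shift of the real line to \<open>Im w = \<pi> / 2\<close>.
\<close>

section \<open>An integrable majorant on the real line\<close>

text \<open>Multiplied by \<open>1 + y\<^sup>2\<close>, the left side still tends to 0 at both ends:
  \<open>exp y\<close> decays at minus infinity, the double exponential at plus infinity. In
  between, compactness bounds it.\<close>

lemma exp_minus_exp_le_inverse_1_plus_square:
  fixes k \<gamma> :: real
  assumes "k > 0" "\<gamma> > 0"
  obtains M where "\<And>y. exp (y - k * exp (\<gamma> * y)) \<le> M * inverse (1 + y\<^sup>2)"
proof -
  define f :: "real \<Rightarrow> real" where "f = (\<lambda>y. (1 + y\<^sup>2) * exp (y - k * exp (\<gamma> * y)))"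
  have "(f \<longlongrightarrow> 0) at_top" "(f \<longlongrightarrow> 0) at_bot"
    unfolding f_def using assms by real_asymp+
  then have "\<forall>\<^sub>F y in at_top. f y < 1" "\<forall>\<^sub>F y in at_bot. f y < 1"
    by (simp_all add: order_tendstoD(2))
  then obtain u l where u: "\<And>y. y \<ge> u \<Longrightarrow> f y < 1" and l: "\<And>y. y \<le> l \<Longrightarrow> f y < 1"
    by (auto simp: eventually_at_top_linorder eventually_at_bot_linorder)
  have "continuous_on {l..u} f"
    unfolding f_def by (intro continuous_intros)
  then have "bounded (f ` {l..u})"
    by (intro compact_imp_bounded compact_continuous_image) auto
  then obtain B where B: "\<And>y. y \<in> {l..u} \<Longrightarrow> \<bar>f y\<bar> \<le> B"
    unfolding bounded_iff by (metis imageI real_norm_def)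
  have "f y \<le> max B 1" for y
    using u[of y] l[of y] B[of y] by (cases "y \<le> l"; cases "y \<ge> u") fastforce+
  moreover have "1 + y\<^sup>2 > 0" for y :: real
    by (simp add: add_pos_nonneg)
  ultimately have "exp (y - k * exp (\<gamma> * y)) \<le> max B 1 * inverse (1 + y\<^sup>2)" for y
    by (simp add: f_def pos_le_divide_eq mult.commute[of "exp _"] flip: divide_inverse)
  then show thesis ..
qed

lemma integrable_if_le_inverse_1_plus_square:
  fixes f :: "real \<Rightarrow> 'a :: {banach, second_countable_topology}"
  assumes "continuous_on UNIV f" and le: "\<And>y. norm (f y) \<le> M * inverse (1 + y\<^sup>2)"
  shows "integrable lborel f"
proof (rule Bochner_Integration.integrable_bound)
  show "integrable lborel (\<lambda>y. M * inverse (1 + y\<^sup>2))"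
    using integrable_inverse_1_plus_square by (simp add: set_integrable_def)
  show "f \<in> borel_measurable lborel"
    using assms(1) by (simp add: borel_measurable_continuous_onI)
  show "AE y in lborel. norm (f y) \<le> norm (M * inverse (1 + y\<^sup>2))"
    using le by (intro AE_I2) (metis abs_ge_self order_trans real_norm_def)
qed

section \<open>Shifting the line of integration\<close>

text \<open>The majorant, uniform over the strip, serves twice: it gives integrability on both
  lines, and it makes the contribution of the vertical edges vanish at infinity.\<close>

lemma integral_vertical_shift:
  fixes f :: "complex \<Rightarrow> complex"
  assumes "f holomorphic_on UNIV" "h \<ge> 0"
    and le: "\<And>y t. 0 \<le> t \<Longrightarrow> t \<le> h \<Longrightarrow> norm (f (Complex y t)) \<le> M * inverse (1 + y\<^sup>2)"
  shows "integrable lborel (\<lambda>y. f (Complex y 0))"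
    and "integrable lborel (\<lambda>y. f (Complex y h))"
    and "(LINT y|lborel. f (Complex y 0)) = (LINT y|lborel. f (Complex y h))"
proof -
  have cont: "continuous_on UNIV f"
    using assms(1) by (rule holomorphic_on_imp_continuous_on)
  have line: "continuous_on UNIV (\<lambda>y. f (Complex y t))" for t
    by (rule continuous_on_compose2[OF cont]) (auto simp: Complex_eq intro!: continuous_intros)
  show int0: "integrable lborel (\<lambda>y. f (Complex y 0))"
    and inth: "integrable lborel (\<lambda>y. f (Complex y h))"
    using line le \<open>h \<ge> 0\<close> by (blast intro: integrable_if_le_inverse_1_plus_square order_refl)+
  obtain g where g: "\<And>z. (g has_field_derivative f z) (at z)"
    using holomorphic_convex_primitive'[of UNIV f] assms(1) by auto
  \<comment> \<open>With a primitive \<open>g\<close> of \<open>f\<close>, the difference of the two integrands is the derivative of \<open>H\<close>,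
    which vanishes at both ends of the line; no contour integral is needed.\<close>
  define H where "H = (\<lambda>y. g (Complex y h) - g (Complex y 0))"
  have "((\<lambda>y. g (Complex y t)) has_vector_derivative f (Complex y t)) (at y)" for y t
  proof -
    have "((\<lambda>y. Complex y t) has_vector_derivative 1) (at y)"
      unfolding Complex_eq by (auto intro!: derivative_eq_intros)
    from field_vector_diff_chain_at[OF this g] show ?thesis
      by (simp add: o_def)
  qed
  then have H: "(H has_vector_derivative f (Complex y h) - f (Complex y 0)) (at y)" for y
    unfolding H_def by (intro has_vector_derivative_diff)
  \<comment> \<open>Along a vertical segment of length \<open>h\<close>, the increment of
    \<open>g\<close> is at most \<open>h\<close> times the bound on its derivative
    \<open>f\<close>.\<close>
  have H_le: "norm (H y) \<le> M * inverse (1 + y\<^sup>2) * h" for y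
  proof -
    let ?S = "closed_segment (Complex y 0) (Complex y h)"
    have "norm (f z) \<le> M * inverse (1 + y\<^sup>2)" if "z \<in> ?S" for z
    proof -
      from that have "z = Complex y (Im z)" "Im z \<in> closed_segment 0 h"
        by (auto simp: closed_segment_same_Re)
      then show ?thesis
        using le[of "Im z" y] \<open>h \<ge> 0\<close> by (auto simp: closed_segment_eq_real_ivl)
    qed
    then have "norm (g (Complex y h) - g (Complex y 0))
      \<le> M * inverse (1 + y\<^sup>2) * norm (Complex y h - Complex y 0)"
      by (intro field_differentiable_bound[where S = ?S and f' = f])
        (auto intro: has_field_derivative_at_within g)
    also have "Complex y h - Complex y 0 = \<i> * of_real h"
      by (simp add: complex_eq_iff)
    finally show ?thesis
      using \<open>h \<ge> 0\<close> by (simp add: H_def norm_mult)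
  qed
  have H_top: "(H \<longlongrightarrow> 0) at_top" and H_bot: "(H \<longlongrightarrow> 0) at_bot"
    by (rule Lim_null_comparison[OF always_eventually[OF allI[OF H_le]]]; real_asymp)+
  have "(LBINT y=-\<infinity>..\<infinity>. f (Complex y h) - f (Complex y 0)) = 0 - 0"
  proof (rule interval_integral_FTC_integrable)
    show "isCont (\<lambda>y. f (Complex y h) - f (Complex y 0)) y" for y
      using line by (simp add: continuous_on_eq_continuous_at)
    show "set_integrable lborel (einterval (- \<infinity>) \<infinity>) (\<lambda>y. f (Complex y h) - f (Complex y 0))"
      using int0 inth by (simp add: set_integrable_def)
  qed (use H H_top H_bot in \<open>simp_all add: ereal_tendsto_simps1\<close>)
  then show "(LINT y|lborel. f (Complex y 0)) = (LINT y|lborel. f (Complex y h))"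
    using int0 inth by (simp add: interval_integral_to_infinity_eq interval_lebesgue_integral_def set_lebesgue_integral_def)
qed

section \<open>Decay of the integrand, uniform over the angles of rotation\<close>

lemma exp_mult_le_exp_plus_const:
  fixes \<alpha> b c :: real
  assumes "0 < \<alpha>" "\<alpha> < 1" "b > 0" "c > 0"
  obtains K where "\<And>y. c * exp (\<alpha> * y) \<le> b * exp y + K"
proof
  fix y
  \<comment> \<open>At \<open>Y\<close> the two sides without constant are equal:
    \<open>b * exp Y = c * exp (\<alpha> * Y)\<close>. To the right \<open>b * exp y\<close>
    dominates; to the left monotonicity bounds \<open>c * exp (\<alpha> * y)\<close> by its value at
    \<open>Y\<close>.\<close>
  define Y where "Y = ln (c / b) / (1 - \<alpha>)"
  show "c * exp (\<alpha> * y) \<le> b * exp y + c * exp (\<alpha> * Y)"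
  proof (cases "y \<le> Y")
    case True
    then have "c * exp (\<alpha> * y) \<le> c * exp (\<alpha> * Y)"
      using assms by simp
    then show ?thesis
      using assms by (simp add: add_increasing)
  next
    case False
    then have "ln (c / b) \<le> y * (1 - \<alpha>)"
      using assms by (simp add: Y_def field_simps)
    then have "exp (ln (c / b)) \<le> exp (y - \<alpha> * y)"
      unfolding exp_le_cancel_iff by (simp add: algebra_simps)
    then have "c * exp (\<alpha> * y) \<le> b * exp y"
      using assms by (simp add: exp_diff field_simps)
    then show ?thesis
      using assms by (simp add: add_increasing2)
  qed
qed

text \<open>The \<open>cos\<close> term may be negative. Near \<open>\<theta> = 0\<close> it is bounded below by a positive constant; for the
  remaining angles \<open>sin \<theta>\<close> is, and \<open>exp y\<close> dominates \<open>exp (\<alpha> * y)\<close> up to a constant as \<open>\<alpha> < 1\<close>.\<close>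

lemma sector_exponent_lower_bound:
  fixes \<alpha> a d \<phi> :: real
  assumes "0 < \<alpha>" "\<alpha> < 1" "a > 0" "d > 0" and \<phi>: "\<bar>\<phi>\<bar> < pi / 2"
  obtains k K where "k > 0"
    "\<And>y \<theta>. 0 \<le> \<theta> \<Longrightarrow> \<theta> \<le> pi / 2 \<Longrightarrow>
       k * exp (\<alpha> * y) - K \<le> a * exp y * sin \<theta> + d * exp (\<alpha> * y) * cos (\<phi> + \<alpha> * \<theta>)"
proof -
  \<comment> \<open>The choice of \<open>\<theta>\<^sub>0\<close> lets
    \<open>\<alpha> * \<theta>\<close> cover at most half the distance from \<open>\<phi>\<close> to
    \<open>pi / 2\<close>. So \<open>\<phi> + \<alpha> * \<theta>\<close> lies between
    \<open>\<phi>\<close> and the midpoint \<open>(pi / 2 + \<phi>) / 2\<close>, and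
    \<open>m\<close> bounds its modulus.\<close>
  define m where "m = max \<bar>\<phi>\<bar> ((pi / 2 + \<phi>) / 2)"
  define \<theta>\<^sub>0 where "\<theta>\<^sub>0 = min (pi / 2) ((pi / 2 - \<phi>) / (2 * \<alpha>))"
  have m: "0 \<le> m" "m < pi / 2" and \<theta>\<^sub>0: "0 < \<theta>\<^sub>0" "\<theta>\<^sub>0 \<le> pi / 2"
    using \<phi> \<open>0 < \<alpha>\<close> by (simp_all only: m_def \<theta>\<^sub>0_def abs_less_iff max_less_iff_conj min_less_iff_conj le_max_iff_disj min.cobounded1) (auto simp: divide_simps)
  define k where "k = d * cos m"
  have "k > 0"
    using m \<open>d > 0\<close> by (auto simp: k_def intro!: mult_pos_pos cos_gt_zero_pi)
  have s: "sin \<theta>\<^sub>0 > 0"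
    using \<theta>\<^sub>0 pi_gt_zero by (intro sin_gt_zero) linarith+
  \<comment> \<open>The coefficient \<open>k + d\<close> absorbs the worst case -1 of the cosine and
    still leaves \<open>k\<close>.\<close>
  obtain K where K: "\<And>y. (k + d) * exp (\<alpha> * y) \<le> a * sin \<theta>\<^sub>0 * exp y + K"
    using exp_mult_le_exp_plus_const[of \<alpha> "a * sin \<theta>\<^sub>0" "k + d"] assms s \<open>k > 0\<close> by auto
  \<comment> \<open>The small angles need a nonnegative constant, hence
    \<open>max 0 K\<close>.\<close>
  have "k * exp (\<alpha> * y) - max 0 K \<le> a * exp y * sin \<theta> + d * exp (\<alpha> * y) * cos (\<phi> + \<alpha> * \<theta>)"
    if \<theta>: "0 \<le> \<theta>" "\<theta> \<le> pi / 2" for y \<theta>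
  proof (cases "\<theta> \<le> \<theta>\<^sub>0")
    case True
    then have "\<alpha> * \<theta> \<le> (pi / 2 - \<phi>) / 2"
      using \<open>0 < \<alpha>\<close> by (simp add: \<theta>\<^sub>0_def field_simps)
    moreover have "0 \<le> \<alpha> * \<theta>"
      using \<theta> \<open>0 < \<alpha>\<close> by simp
    ultimately have "\<bar>\<phi> + \<alpha> * \<theta>\<bar> \<le> m"
      by (auto simp: m_def abs_if max_def field_simps split: if_splits)
    then have "cos m \<le> cos \<bar>\<phi> + \<alpha> * \<theta>\<bar>"
      using m by (intro cos_monotone_0_pi_le) auto
    then have "k * exp (\<alpha> * y) \<le> d * exp (\<alpha> * y) * cos (\<phi> + \<alpha> * \<theta>)"
      using \<open>d > 0\<close> by (simp add: k_def)
    moreover have "0 \<le> a * exp y * sin \<theta>"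
      using \<theta> \<open>a > 0\<close> pi_gt_zero by (intro mult_nonneg_nonneg sin_ge_zero) (simp_all add: exp_ge_zero)
    ultimately show ?thesis
      by linarith
  next
    case False
    then have "sin \<theta>\<^sub>0 \<le> sin \<theta>"
      using \<theta> \<theta>\<^sub>0 pi_gt_zero by (intro sin_monotone_2pi_le) linarith+
    then have "a * exp y * sin \<theta>\<^sub>0 \<le> a * exp y * sin \<theta>"
      using \<open>a > 0\<close> by simp
    moreover have "d * exp (\<alpha> * y) * (-1) \<le> d * exp (\<alpha> * y) * cos (\<phi> + \<alpha> * \<theta>)"
      using \<open>d > 0\<close> by (intro mult_left_mono) auto
    moreover have "(k + d) * exp (\<alpha> * y) \<le> a * exp y * sin \<theta>\<^sub>0 + K"
      using K[of y] by (simp add: mult_ac)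
    ultimately show ?thesis
      unfolding distrib_right by linarith
  qed
  with \<open>k > 0\<close> show thesis ..
qed

section \<open>Rotation of the half-line integral, for \<open>a\<close> the modulus of
  \<open>x'\<close> and \<open>D\<close> either \<open>C\<close> or its conjugate\<close>

context
  fixes \<alpha> a :: real and D :: complex
  assumes \<alpha>: "0 < \<alpha>" "\<alpha> < 1" and a: "a > 0" and D: "Re D > 0"
begin

text \<open>The oscillating factor has modulus 1, so only
  \<open>exp (- Re D * \<xi> powr \<alpha>)\<close> matters; the substitution
  \<open>\<xi> = exp y\<close> brings it to the majorized form.\<close>

lemma half_line_integrand_integrable:
  "set_integrable lborel {0<..} (\<lambda>\<xi>. exp (\<i> * of_real (a * \<xi>) - D * of_real (\<xi> powr \<alpha>)))"
proof -
  let ?f = "\<lambda>\<xi>. exp (- Re D * \<xi> powr \<alpha>)"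
  obtain M where M: "\<And>y. exp (y - Re D * exp (\<alpha> * y)) \<le> M * inverse (1 + y\<^sup>2)"
    using exp_minus_exp_le_inverse_1_plus_square D \<alpha> by blast
  have "integrable lborel (\<lambda>y. exp (y - Re D * exp (\<alpha> * y)))"
    by (rule integrable_if_le_inverse_1_plus_square[where M = M])
      (auto intro!: continuous_intros M)
  then have int: "set_integrable lborel (einterval (- \<infinity>) \<infinity>) (\<lambda>y. ?f (exp y) * exp y)"
    by (simp add: set_integrable_def powr_def exp_diff exp_minus field_simps)
  have "set_integrable lborel (einterval 0 \<infinity>) ?f"
  proof (rule interval_integral_substitution_nonneg(1))
    show "((ereal \<circ> exp \<circ> real_of_ereal) \<longlongrightarrow> 0) (at_right (- \<infinity>))"
      unfolding zero_ereal_def by (simp add: ereal_tendsto_simps exp_at_bot)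
    show "((ereal \<circ> exp \<circ> real_of_ereal) \<longlongrightarrow> \<infinity>) (at_left \<infinity>)"
      by (simp add: ereal_tendsto_simps exp_at_top)
  qed (use int in \<open>auto intro!: derivative_eq_intros continuous_intros\<close>)
  then have bound: "set_integrable lborel {0<..} ?f"
    by (simp add: zero_ereal_def)
  show ?thesis
  proof (rule set_integrable_bound[OF bound])
    show "set_borel_measurable lborel {0<..} (\<lambda>\<xi>. exp (\<i> * of_real (a * \<xi>) - D * of_real (\<xi> powr \<alpha>)))"
      unfolding set_borel_measurable_def by measurable
  qed (auto simp: norm_exp_eq_Re)
qed

text \<open>On the line with imaginary part \<open>pi / 2\<close>, \<open>exp w\<close> equals
  \<open>\<i> * exp y\<close>, so the oscillation \<open>\<i> * a * exp w\<close> becomes the decay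
  \<open>- a * exp y\<close>, while \<open>D\<close> is turned by the angle
  \<open>\<alpha> * pi / 2\<close>.\<close>

lemma half_line_integral_rotated:
  defines "f \<equiv> \<lambda>y. exp (y - a * exp y - cmod D * cos (Arg D + \<alpha> * pi / 2) * exp (\<alpha> * y))
    * sin (cmod D * sin (Arg D + \<alpha> * pi / 2) * exp (\<alpha> * y))"
  shows "integrable lborel f"
    and "Re (LINT \<xi>:{0<..}|lborel. exp (\<i> * of_real (a * \<xi>) - D * of_real (\<xi> powr \<alpha>)))
      = (LINT y|lborel. f y)"
proof -
  define F where "F = (\<lambda>\<xi>. exp (\<i> * of_real (a * \<xi>) - D * of_real (\<xi> powr \<alpha>)))"
  \<comment> \<open>The summand \<open>w\<close> in the exponent is the Jacobian of
    \<open>\<xi> = exp w\<close>.\<close>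
  define g where "g = (\<lambda>w. exp (w + \<i> * of_real a * exp w - D * exp (of_real \<alpha> * w)))"
  have D_pos: "cmod D > 0" and Arg: "\<bar>Arg D\<bar> < pi / 2"
    using D Arg_Re_pos[of D] by auto
  have D_rot: "D * exp (of_real \<alpha> * Complex y \<theta>)
      = of_real (cmod D * exp (\<alpha> * y)) * cis (Arg D + \<alpha> * \<theta>)" for y \<theta>
  proof -
    have "D = of_real (cmod D) * cis (Arg D)"
      using rcis_cmod_Arg[of D] by (simp add: rcis_def)
    moreover have "exp (of_real \<alpha> * Complex y \<theta>) = of_real (exp (\<alpha> * y)) * cis (\<alpha> * \<theta>)"
      by (simp add: exp_eq_polar)
    ultimately show ?thesis
      by (metis (no_types, lifting) cis_mult mult.assoc mult.left_commute of_real_mult)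
  qed
  have exp_Complex: "exp (Complex y \<theta>) = of_real (exp y) * cis \<theta>" for y \<theta>
    by (simp add: exp_eq_polar)
  have exponent: "Complex y \<theta> + \<i> * of_real a * exp (Complex y \<theta>) - D * exp (of_real \<alpha> * Complex y \<theta>)
    = Complex (y - (a * exp y * sin \<theta> + cmod D * exp (\<alpha> * y) * cos (Arg D + \<alpha> * \<theta>)))
       (\<theta> + a * exp y * cos \<theta> - cmod D * exp (\<alpha> * y) * sin (Arg D + \<alpha> * \<theta>))" for y \<theta>
    unfolding D_rot exp_Complex by (simp add: complex_eq_iff)
  obtain k K where "k > 0" and kK:
    "\<And>y \<theta>. 0 \<le> \<theta> \<Longrightarrow> \<theta> \<le> pi / 2 \<Longrightarrow> k * exp (\<alpha> * y) - K
       \<le> a * exp y * sin \<theta> + cmod D * exp (\<alpha> * y) * cos (Arg D + \<alpha> * \<theta>)"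
    using sector_exponent_lower_bound[OF \<alpha> a D_pos Arg] by metis
  obtain M where M: "\<And>y. exp (y - k * exp (\<alpha> * y)) \<le> M * inverse (1 + y\<^sup>2)"
    using exp_minus_exp_le_inverse_1_plus_square \<open>k > 0\<close> \<alpha> by blast
  have g_le: "norm (g (Complex y \<theta>)) \<le> exp K * M * inverse (1 + y\<^sup>2)"
    if "0 \<le> \<theta>" "\<theta> \<le> pi / 2" for y \<theta>
  proof -
    have "norm (g (Complex y \<theta>)) \<le> exp (K + (y - k * exp (\<alpha> * y)))"
      using kK[OF that, of y] by (simp add: g_def exponent norm_exp_eq_Re)
    also have "\<dots> \<le> exp K * (M * inverse (1 + y\<^sup>2))"
      unfolding exp_add by (intro mult_left_mono M) simp
    finally show ?thesis
      by (simp add: mult.assoc)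
  qed
  have hol: "g holomorphic_on UNIV"
    unfolding g_def by (intro holomorphic_intros)
  have "0 \<le> pi / 2"
    by simp
  note shift = integral_vertical_shift[OF hol this g_le]
  \<comment> \<open>At \<open>\<theta> = pi / 2\<close> the imaginary part of the exponent is
    \<open>pi / 2\<close> minus the argument of the sine in \<open>f\<close>; the real part of
    \<open>g\<close> thus carries a sine.\<close>
  have "cos (pi / 2 - t) = sin t" for t
    by (simp add: cos_diff)
  then have g_top: "Re (g (Complex y (pi / 2))) = f y" for y
    unfolding g_def exponent
    by (simp add: f_def Re_exp mult_ac diff_diff_eq)
  have g_bottom: "g (Complex y 0) = exp y *\<^sub>R F (exp y)" for y
    by (simp add: g_def F_def Complex_eq exp_add exp_diff exp_of_real powr_def scaleR_conv_of_real
        of_real_exp mult_ac flip: exp_of_real)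
  show "integrable lborel f"
    using integrable_Re[OF shift(2)] by (simp add: g_top)
  have "(LBINT \<xi>=0..\<infinity>. F \<xi>) = (LBINT y=-\<infinity>..\<infinity>. exp y *\<^sub>R F (exp y))"
  proof (rule interval_integral_substitution_integrable)
    show "((ereal \<circ> exp \<circ> real_of_ereal) \<longlongrightarrow> 0) (at_right (- \<infinity>))"
      unfolding zero_ereal_def by (simp add: ereal_tendsto_simps exp_at_bot)
    show "((ereal \<circ> exp \<circ> real_of_ereal) \<longlongrightarrow> \<infinity>) (at_left \<infinity>)"
      by (simp add: ereal_tendsto_simps exp_at_top)
    show "set_integrable lborel (einterval (- \<infinity>) \<infinity>) (\<lambda>y. exp y *\<^sub>R F (exp y))"
      using shift(1) by (simp add: set_integrable_def flip: g_bottom)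
    show "set_integrable lborel (einterval 0 \<infinity>) F"
      using half_line_integrand_integrable by (simp add: F_def zero_ereal_def)
    show "isCont F (exp y)" for y
      unfolding F_def by (intro continuous_intros) auto
  qed (auto intro!: derivative_eq_intros continuous_intros)
  then have "(LINT \<xi>:{0<..}|lborel. F \<xi>) = (LINT y|lborel. g (Complex y (pi / 2)))"
    by (simp add: shift(3) interval_lebesgue_integral_def set_lebesgue_integral_def zero_ereal_def
        flip: g_bottom)
  then show "Re (LINT \<xi>:{0<..}|lborel. exp (\<i> * of_real (a * \<xi>) - D * of_real (\<xi> powr \<alpha>)))
      = (LINT y|lborel. f y)"
    using shift(2) by (simp add: F_def g_top flip: integral_Re)
qed

end

section \<open>From the density to the half-line integral\<close>

lemma integral_eq_two_Re_half_line:
  fixes F :: "real \<Rightarrow> complex"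
  assumes F_measurable: "F \<in> borel_measurable lborel"
    and int: "set_integrable lborel {0<..} F" and sym: "\<And>\<xi>. \<xi> > 0 \<Longrightarrow> F (- \<xi>) = cnj (F \<xi>)"
  shows "(LINT \<xi>|lborel. F \<xi>) = of_real (2 * Re (LINT \<xi>:{0<..}|lborel. F \<xi>))"
proof -
  define G where "G = (\<lambda>\<xi>. indicator {0<..} \<xi> *\<^sub>R F \<xi>)"
  have G: "integrable lborel G"
    using int by (simp add: G_def set_integrable_def)
  have G': "integrable lborel (\<lambda>\<xi>. G (0 + (-1) * \<xi>))"
    by (rule lborel_integrable_real_affine[OF G]) simp
  have cnjG: "integrable lborel (\<lambda>\<xi>. cnj (G (- \<xi>)))"
    using G' by simp
  \<comment> \<open>The point 0 is excluded: there the right side is 0, whatever the value of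
    \<open>F\<close>.\<close>
  have eq: "AE \<xi> in lborel. F \<xi> = G \<xi> + cnj (G (- \<xi>))"
    using AE_lborel_singleton[of 0]
  proof eventually_elim
    case (elim \<xi>)
    then show ?case
      using sym[of \<xi>] sym[of "- \<xi>"] by (cases "\<xi> > 0") (auto simp: G_def)
  qed
  have "(LINT \<xi>|lborel. F \<xi>) = (LINT \<xi>|lborel. G \<xi> + cnj (G (- \<xi>)))"
    using F_measurable _ eq
    by (rule integral_cong_AE) (intro borel_measurable_integrable Bochner_Integration.integrable_add G cnjG)
  also have "\<dots> = (LINT \<xi>|lborel. G \<xi>) + cnj (LINT \<xi>|lborel. G \<xi>)"
    using G cnjG lborel_integral_real_affine[of "-1" G 0] by simp
  also have "\<dots> = of_real (2 * Re (LINT \<xi>|lborel. G \<xi>))"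
    by (simp add: complex_add_cnj)
  finally show ?thesis
    by (simp add: G_def set_lebesgue_integral_def)
qed

text \<open>Prescribing \<open>h\<close> only for positive \<xi> lets each sign of \<open>x'\<close>
  supply the integrand in the form in which its integrability is known.\<close>

lemma stable_density_eq_half_line:
  assumes C: "C = stable_C_plus \<alpha> \<sigma> \<beta>"
    and eq: "\<And>\<xi>. \<xi> > 0 \<Longrightarrow> h \<xi> = exp (- \<i> * of_real (x' * \<xi>) - C * of_real (\<xi> powr \<alpha>))"
    and int: "set_integrable lborel {0<..} h"
  shows "stable_density \<alpha> \<sigma> \<beta> x' = of_real (1 / pi * Re (LINT \<xi>:{0<..}|lborel. h \<xi>))"
proof -
  define F where "F = (\<lambda>\<xi>. exp (- \<i> * of_real (x' * \<xi>) - stable_exponent \<alpha> \<sigma> \<beta> \<xi>))"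
  have hF: "h \<xi> = F \<xi>" if "\<xi> > 0" for \<xi>
    using that by (simp add: eq F_def C stable_exponent_pos)
  have "(LINT \<xi>|lborel. F \<xi>) = of_real (2 * Re (LINT \<xi>:{0<..}|lborel. F \<xi>))"
  proof (rule integral_eq_two_Re_half_line)
    show "F \<in> borel_measurable lborel"
      unfolding F_def stable_exponent_def by measurable
    have "set_integrable lborel {0<..} h = set_integrable lborel {0<..} F"
      by (rule set_integrable_cong) (auto simp: hF)
    with int show "set_integrable lborel {0<..} F"
      by simp
    show "F (- \<xi>) = cnj (F \<xi>)" if "\<xi> > 0" for \<xi>
      using that by (simp add: F_def stable_exponent_pos stable_exponent_neg exp_cnj)
  qed
  also have "(LINT \<xi>:{0<..}|lborel. F \<xi>) = (LINT \<xi>:{0<..}|lborel. h \<xi>)"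
    by (rule set_lebesgue_integral_cong) (auto simp: hF)
  finally show ?thesis
    by (simp add: stable_density_def F_def)
qed

text \<open>Integrability is asserted with each formula, because the integral of a non-integrable
  function is 0 by convention.\<close>

theorem mainTheorem1:
  fixes \<alpha> \<sigma> \<beta> \<phi>\<^sub>0 x' :: real and C :: complex
  assumes "0 < \<alpha>" "\<alpha> < 1" "\<sigma> > 0" "- 1 \<le> \<beta>" "\<beta> \<le> 1"
    and "C = stable_C_plus \<alpha> \<sigma> \<beta>"
    and "\<phi>\<^sub>0 = Arg C"
    and "x' \<noteq> 0"
    and "\<bar>x'\<bar> + cmod C * cos (\<phi>\<^sub>0 - sgn x' * (\<alpha> * pi / 2)) > 0"
  shows
    "(x' < 0 \<longrightarrow>
       (let f = (\<lambda>y::real.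
          exp (y + x' * exp y - cmod C * cos (\<phi>\<^sub>0 + \<alpha> * pi / 2) * exp (\<alpha> * y))
            * sin (cmod C * sin (\<phi>\<^sub>0 + \<alpha> * pi / 2) * exp (\<alpha> * y)))
        in integrable lborel f \<and>
           stable_density \<alpha> \<sigma> \<beta> x' = complex_of_real (1 / pi * (LINT y|lborel. f y)))) \<and>
     (x' > 0 \<longrightarrow>
       (let f = (\<lambda>y::real.
          exp (y - x' * exp y - cmod C * cos (\<phi>\<^sub>0 - \<alpha> * pi / 2) * exp (\<alpha> * y))
            * sin (cmod C * sin (\<phi>\<^sub>0 - \<alpha> * pi / 2) * exp (\<alpha> * y)))
        in integrable lborel f \<and>
           stable_density \<alpha> \<sigma> \<beta> x' = complex_of_real (- (1 / pi) * (LINT y|lborel. f y))))"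
proof -
  have ReC: "Re C > 0"
    using assms by (simp add: stable_C_plus_def)
  \<comment> \<open>Conjugation negates \<open>Arg\<close> except on the negative reals, where it
    stays \<open>pi\<close>; a positive real part rules these out.\<close>
  then have "C \<notin> \<real> \<or> Arg C = 0"
    by (simp add: Arg_eq_0)
  then have Arg_cnj_C: "Arg (cnj C) = - Arg C"
    by (auto simp: Arg_cnj)
  \<comment> \<open>For \<open>D = cnj C\<close> the rotated angle is the negative of the one in
    (ii): the cosine is unchanged, and the sine yields the minus sign in front of the
    integral.\<close>
  have arg: "Arg (cnj C) + \<alpha> * pi / 2 = - (\<phi>\<^sub>0 - \<alpha> * pi / 2)"
    using assms(7) by (simp add: Arg_cnj_C)
  have ReC': "Re (cnj C) > 0"
    using ReC by simp
  show ?thesis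
  proof (intro conjI impI)
    assume "x' < 0"
    then have a: "- x' > 0"
      by simp
    note half = half_line_integrand_integrable[OF assms(1,2) a ReC]
      half_line_integral_rotated[OF assms(1,2) a ReC]
    have density: "stable_density \<alpha> \<sigma> \<beta> x' = of_real (1 / pi *
        Re (LINT \<xi>:{0<..}|lborel. exp (\<i> * of_real (- x' * \<xi>) - C * of_real (\<xi> powr \<alpha>))))"
      by (rule stable_density_eq_half_line[OF assms(6) _ half(1)]) simp
    show "let f = (\<lambda>y::real.
          exp (y + x' * exp y - cmod C * cos (\<phi>\<^sub>0 + \<alpha> * pi / 2) * exp (\<alpha> * y))
            * sin (cmod C * sin (\<phi>\<^sub>0 + \<alpha> * pi / 2) * exp (\<alpha> * y)))
        in integrable lborel f \<and>
           stable_density \<alpha> \<sigma> \<beta> x' = complex_of_real (1 / pi * (LINT y|lborel. f y))"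
      using half(2) density assms(7) unfolding half(3) by (simp add: Let_def)
  next
    assume a: "x' > 0"
    note half = half_line_integrand_integrable[OF assms(1,2) a ReC']
      half_line_integral_rotated[OF assms(1,2) a ReC']
    let ?h = "\<lambda>\<xi>. exp (\<i> * of_real (x' * \<xi>) - cnj C * of_real (\<xi> powr \<alpha>))"
    have int: "set_integrable lborel {0<..} (\<lambda>\<xi>. cnj (?h \<xi>))"
      using half(1) unfolding set_integrable_def by (auto dest: integrable_cnj)
    \<comment> \<open>For positive \<open>x'\<close> the half-line integrand is the conjugate of
      \<open>?h\<close>, to which the rotation with \<open>D = cnj C\<close> applies; real parts
      agree.\<close>
    have "Re (LINT \<xi>:{0<..}|lborel. cnj (?h \<xi>)) = Re (cnj (LINT \<xi>:{0<..}|lborel. ?h \<xi>))"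
      unfolding set_lebesgue_integral_def Bochner_Integration.integral_cnj[symmetric] by simp
    moreover have "stable_density \<alpha> \<sigma> \<beta> x' =
        of_real (1 / pi * Re (LINT \<xi>:{0<..}|lborel. cnj (?h \<xi>)))"
      by (rule stable_density_eq_half_line[OF assms(6) _ int]) (simp add: exp_cnj)
    ultimately show "let f = (\<lambda>y::real.
          exp (y - x' * exp y - cmod C * cos (\<phi>\<^sub>0 - \<alpha> * pi / 2) * exp (\<alpha> * y))
            * sin (cmod C * sin (\<phi>\<^sub>0 - \<alpha> * pi / 2) * exp (\<alpha> * y)))
        in integrable lborel f \<and>
           stable_density \<alpha> \<sigma> \<beta> x' = complex_of_real (- (1 / pi) * (LINT y|lborel. f y))"
      using half(2,3) unfolding arg cos_minus sin_minus by (simp add: Let_def)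
  qed
qed

end
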